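(* Let $\phi$ be an inner function on the unit disc $\mathbb{D}$, with Clark measure $\sigma_\alpha$ for some unimodular constant $\alpha \in \mathbb{T}$. Let $\tau_\alpha$ be the Clark measure, corresponding to the same $\alpha$, of the inner function $\Phi(z_1,z_2) := \phi(z_1 z_2)$ on $\mathbb{D}^2$. Then, for any function $f \in C(\mathbb{T}^2)$, $$\int_{\mathbb{T}^2} f(\xi)\, d\tau_\alpha(\xi) = \int_{\mathbb{T}} \left( \int_{\mathbb{T}} f(\zeta, x\overline{\zeta})\, d\sigma_\alpha(x) \right) dm(\zeta).$$
   Context: $\mathbb{D}^d = \{z \in \mathbb{C}^d : |z_j| < 1,\ j=1,\dots,d\}$ and $\mathbb{T}^d = \{\zeta \in \mathbb{C}^d : |\zeta_j| = 1,\ j=1,\dots,d\}$; $m_d$ is normalized Lebesgue measure on $\mathbb{T}^d$ and $m = m_1$. A bounded holomorphic function $\phi : \mathbb{D}^d \to \mathbb{D}$ is inner if its non-tangential boundary values $\phi^*(\zeta)$, which exist for $m_d$-almost every $\zeta \in \mathbb{T}^d$, satisfy $|\phi^*(\zeta)| = 1$ for $m_d$-almost every $\zeta \in \mathbb{T}^d$. The Poisson kernel is $P(z,\zeta) = \prod_{j=1}^d \frac{1-|z_j|^2}{|\zeta_j - z_j|^2}$ for $z \in \mathbb{D}^d$, $\zeta \in \mathbb{T}^d$. For an inner function $\phi$ on $\mathbb{D}^d$ and $\alpha \in \mathbb{T}$, the Clark measure of $\phi$ associated to $\alpha$ is the unique positive Borel measure $\sigma_\alpha$ on $\mathbb{T}^d$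 with $$\frac{1-|\phi(z)|^2}{|\alpha - \phi(z)|^2} = \int_{\mathbb{T}^d} P(z,\zeta)\, d\sigma_\alpha(\zeta), \quad z \in \mathbb{D}^d.$$ *)

theory Defs
  imports "HOL-Complex_Analysis.Complex_Analysis"
begin

text \<open>
  The unit disc is \<^term>\<open>ball (0::complex) 1\<close>, the circle is \<^term>\<open>sphere (0::complex) 1\<close>;
  the bidisc and the 2-torus are the corresponding products in \<^typ>\<open>complex \<times> complex\<close>.
\<close>

definition circle_measure :: "complex measure" where
  "circle_measure =
     distr (uniform_measure lborel {0..<2*pi}) (restrict_space borel (sphere 0 1)) cis"

definition stolz_region :: "complex \<Rightarrow> real \<Rightarrow> complex set" where
  "stolz_region \<zeta> M = {z \<in> ball 0 1. cmod (\<zeta> - z) \<le> M * (1 - cmod z)}"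

text \<open>For \<open>M < 1\<close> the region is empty and the limit along it is vacuous; the limit \<open>w\<close> is
  pinned down by the regions with \<open>M \<ge> 1\<close>.\<close>

definition nontangential_limit :: "(complex \<Rightarrow> complex) \<Rightarrow> complex \<Rightarrow> complex \<Rightarrow> bool" where
  "nontangential_limit \<phi> \<zeta> w \<longleftrightarrow> (\<forall>M. (\<phi> \<longlongrightarrow> w) (at \<zeta> within stolz_region \<zeta> M))"

definition inner_function :: "(complex \<Rightarrow> complex) \<Rightarrow> bool" where
  "inner_function \<phi> \<longleftrightarrow>
     \<phi> holomorphic_on ball 0 1 \<and> \<phi> ` ball 0 1 \<subseteq> ball 0 1 \<and>
     (AE \<zeta> in circle_measure. \<exists>w. nontangential_limit \<phi> \<zeta> w \<and> cmod w = 1)"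

definition poisson_disc :: "complex \<Rightarrow> complex \<Rightarrow> real" where
  "poisson_disc z \<zeta> = (1 - (cmod z)\<^sup>2) / (cmod (\<zeta> - z))\<^sup>2"

definition poisson_bidisc :: "complex \<times> complex \<Rightarrow> complex \<times> complex \<Rightarrow> real" where
  "poisson_bidisc z \<zeta> = poisson_disc (fst z) (fst \<zeta>) * poisson_disc (snd z) (snd \<zeta>)"

text \<open>
  The Clark measure is characterised by its Poisson integral. At \<open>z = 0\<close> the kernel is 1, so
  integrability there makes the measure finite. The identity only involves the values of the
  function, so innerness is not part of the predicates.
\<close>

definition clark_measure_disc ::
    "(complex \<Rightarrow> complex) \<Rightarrow> complex \<Rightarrow> complex measure \<Rightarrow> bool" where
  "clark_measure_disc \<phi> \<alpha> \<sigma> \<longleftrightarrow>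
     sets \<sigma> = sets (restrict_space borel (sphere 0 1)) \<and>
     (\<forall>z \<in> ball 0 1. has_bochner_integral \<sigma> (poisson_disc z)
        ((1 - (cmod (\<phi> z))\<^sup>2) / (cmod (\<alpha> - \<phi> z))\<^sup>2))"

definition clark_measure_bidisc ::
    "(complex \<times> complex \<Rightarrow> complex) \<Rightarrow> complex \<Rightarrow> (complex \<times> complex) measure \<Rightarrow> bool" where
  "clark_measure_bidisc \<Phi> \<alpha> \<tau> \<longleftrightarrow>
     sets \<tau> = sets (restrict_space borel (sphere 0 1 \<times> sphere 0 1)) \<and>
     (\<forall>z \<in> ball 0 1 \<times> ball 0 1. has_bochner_integral \<tau> (poisson_bidisc z)
        ((1 - (cmod (\<Phi> z))\<^sup>2) / (cmod (\<alpha> - \<Phi> z))\<^sup>2))"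

end

theory Submission
  imports Defs
begin

text \<open>
  A finite measure on the torus is determined by its Poisson integral: by symmetry of the kernel on
  tori of radius \<open>r\<close>, integrating the Poisson integral against a trigonometric monomial recovers the
  corresponding moment up to a power of \<open>r\<close>, and trigonometric polynomials are dense. The right-hand
  side is integration against the image of \<open>m \<times> \<sigma>\<close> under \<open>(\<zeta>, x) \<mapsto> (\<zeta>, x * cnj \<zeta>)\<close>. The convolution
  identity for Poisson kernels shows that its Poisson integral at \<open>(z\<^sub>1, z\<^sub>2)\<close> is the Poisson integral
  of \<open>\<sigma>\<close> at \<open>z\<^sub>1 * z\<^sub>2\<close>, which is that of \<open>\<tau>\<close>.
\<close>

section \<open>Integrability and Fubini for finite measures\<close>

lemma integrable_continuous_compact_support:
  fixes f :: "'a::topological_space \<Rightarrow> 'b::{banach, second_countable_topology}"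
  assumes "finite_measure M" and sets: "sets M = sets (restrict_space borel S)"
    and "compact S" and "continuous_on S f"
  shows "integrable M f"
proof -
  interpret finite_measure M by fact
  have space: "space M = S"
    using sets_eq_imp_space_eq[OF sets] by (simp add: space_restrict_space)
  have "f \<in> borel_measurable (restrict_space borel S)"
    using assms by (intro borel_measurable_continuous_on_restrict)
  then have "f \<in> borel_measurable M"
    using sets measurable_cong_sets by blast
  moreover have "bounded (f ` S)"
    using assms by (intro compact_imp_bounded compact_continuous_image)
  then obtain B where "\<And>x. x \<in> S \<Longrightarrow> norm (f x) \<le> B"
    by (auto simp: bounded_iff)
  ultimately show ?thesis
    using space by (intro integrable_const_bound[where B = B]) auto
qed

text \<open>For two finite measures a uniform bound on the product space already gives integrability
  there, so each use has to supply only joint measurability and a bound.\<close>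

lemma finite_measure_Fubini:
  fixes f :: "'a \<Rightarrow> 'b \<Rightarrow> 'c::{banach, second_countable_topology}"
  assumes "finite_measure M" "finite_measure N"
    and meas: "case_prod f \<in> borel_measurable (M \<Otimes>\<^sub>M N)"
    and bound: "\<And>x y. x \<in> space M \<Longrightarrow> y \<in> space N \<Longrightarrow> norm (f x y) \<le> B"
  shows finite_measure_Fubini_swap:
      "(\<integral>x. (\<integral>y. f x y \<partial>N) \<partial>M) = (\<integral>y. (\<integral>x. f x y \<partial>M) \<partial>N)"
    and finite_measure_Fubini_pair:
      "(\<integral>x. (\<integral>y. f x y \<partial>N) \<partial>M) = integral\<^sup>L (M \<Otimes>\<^sub>M N) (case_prod f)"
proof -
  interpret M: finite_measure M by fact
  interpret N: finite_measure N by fact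
  interpret pair_sigma_finite M N ..
  interpret MN: finite_measure "M \<Otimes>\<^sub>M N"
    by (intro finite_measure_pair_measure assms)
  have int: "integrable (M \<Otimes>\<^sub>M N) (case_prod f)"
    using meas bound by (intro MN.integrable_const_bound[where B = B]) (auto simp: space_pair_measure)
  show "(\<integral>x. (\<integral>y. f x y \<partial>N) \<partial>M) = (\<integral>y. (\<integral>x. f x y \<partial>M) \<partial>N)"
    using Fubini_integral[OF int] by simp
  show "(\<integral>x. (\<integral>y. f x y \<partial>N) \<partial>M) = integral\<^sup>L (M \<Otimes>\<^sub>M N) (case_prod f)"
    by (rule integral_fst[OF int])
qed

section \<open>Normalized arc length on the circle\<close>

lemma sets_circle_measure [measurable_cong]:
  "sets circle_measure = sets (restrict_space borel (sphere 0 1))"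
  by (simp add: circle_measure_def)

lemma space_circle_measure [simp]: "space circle_measure = sphere 0 1"
  by (simp add: circle_measure_def space_restrict_space)

lemma measurable_cis_circle:
  "cis \<in> measurable (uniform_measure lborel A) (restrict_space borel (sphere 0 1))"
proof -
  have "cis \<in> borel_measurable borel"
    by (intro borel_measurable_continuous_onI continuous_intros)
  then show ?thesis
    by (intro measurable_restrict_space2) (auto simp: dist_norm)
qed

lemma finite_measure_circle_measure: "finite_measure circle_measure"
proof -
  have "finite_measure (uniform_measure lborel {0..<2*pi})"
    by (rule finite_measureI) (simp add: ennreal_divide_eq_top_iff divide_ennreal)
  then show ?thesis
    unfolding circle_measure_def
    by (rule finite_measure.finite_measure_distr[OF _ measurable_cis_circle])
qed

lemma integrable_circle_measure:
  fixes f :: "complex \<Rightarrow> 'b::{banach, second_countable_topology}"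
  assumes "continuous_on (sphere 0 1) f"
  shows "integrable circle_measure f"
  by (rule integrable_continuous_compact_support[OF finite_measure_circle_measure
        sets_circle_measure compact_sphere assms])

text \<open>Links the Bochner integral on the circle with the gauge integral over the parameter
  interval, the form that contour integrals along \<open>circlepath\<close> take.\<close>

lemma integral_circle_measure:
  fixes g :: "complex \<Rightarrow> complex"
  assumes cont: "continuous_on (sphere 0 1) g"
  shows "(LINT \<zeta>|circle_measure. g \<zeta>) = integral {0..2*pi} (\<lambda>t. g (cis t)) / (2 * pi)"
proof -
  define h where "h = (\<lambda>t. g (cis t))"
  have conth: "continuous_on UNIV h"
    unfolding h_def by (intro continuous_on_compose2[OF cont] continuous_intros) auto
  have [measurable]: "h \<in> borel_measurable borel"
    using conth by (intro borel_measurable_continuous_onI)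
  have gm: "g \<in> borel_measurable (restrict_space borel (sphere 0 1))"
    by (intro borel_measurable_continuous_on_restrict cont)
  \<comment> \<open>The density is made real-valued here, as \<open>integral_density\<close>
    expects; \<open>2*pi\<close> is the length of the interval.\<close>
  have um: "uniform_measure lborel {0..<2*pi} =
      density lborel (\<lambda>x. ennreal (indicator {0..<2*pi} x / (2*pi)))"
    unfolding uniform_measure_def
    by (intro density_cong) (auto simp: indicator_def divide_ennreal simp flip: ennreal_1)
  have "set_integrable lborel {0..2*pi} h"
    unfolding set_integrable_def
    using borel_integrable_compact[of "{0..2*pi}" h] conth
    by (simp add: continuous_on_subset indicator_scaleR_eq_if)
  then have si: "set_integrable lborel {0..<2*pi} h"
    by (rule set_integrable_subset) auto
  have "(LINT \<zeta>|circle_measure. g \<zeta>) = (LINT t|uniform_measure lborel {0..<2*pi}. h t)"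
    unfolding circle_measure_def h_def by (rule integral_distr[OF measurable_cis_circle gm])
  also have "\<dots> = (LINT t|lborel. (indicator {0..<2*pi} t / (2*pi)) *\<^sub>R h t)"
    unfolding um by (rule integral_density) auto
  also have "\<dots> = (LINT t|lborel. (1 / (2*pi)) *\<^sub>R (indicator {0..<2*pi} t *\<^sub>R h t))"
    by (intro Bochner_Integration.integral_cong) auto
  also have "\<dots> = (1 / (2*pi)) *\<^sub>R (LINT t:{0..<2*pi}|lborel. h t)"
    unfolding set_lebesgue_integral_def by (rule integral_scaleR_right)
  also have "(LINT t:{0..<2*pi}|lborel. h t) = integral {0..<2*pi} h"
    using si by (rule set_borel_integral_eq_integral)
  \<comment> \<open>The half-open interval, on which \<open>cis\<close> is injective, differs from
    the closed one by a single null point.\<close>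
  also have "\<dots> = integral {0..2*pi} h"
    by (rule integral_spike_set; rule negligible_subset[of "{2*pi}"]) auto
  finally show ?thesis by (simp add: h_def scaleR_conv_of_real)
qed

section \<open>The Poisson kernel of the disc\<close>

lemma sphere_minus_ball_neq_0:
  fixes z \<zeta> :: complex
  assumes "z \<in> ball 0 1" "\<zeta> \<in> sphere 0 1"
  shows "\<zeta> - z \<noteq> 0" "1 - cnj z * \<zeta> \<noteq> 0"
proof -
  show "\<zeta> - z \<noteq> 0" using assms by auto
  have "cmod (cnj z * \<zeta>) < 1" using assms by (simp add: norm_mult)
  then show "1 - cnj z * \<zeta> \<noteq> 0" by auto
qed

lemma continuous_on_poisson_disc:
  "z \<in> ball 0 1 \<Longrightarrow> continuous_on (sphere 0 1) (poisson_disc z)"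
  unfolding poisson_disc_def
  using sphere_minus_ball_neq_0(1) by (intro continuous_intros) auto

text \<open>On the circle \<open>cnj \<zeta>\<close> is the inverse of \<open>\<zeta>\<close>, so
  the squared modulus in the denominator becomes rational in \<open>\<zeta>\<close>. In this form
  the kernel can be matched with a Cauchy kernel.\<close>

lemma poisson_disc_complex:
  assumes "cmod \<zeta> = 1"
  shows "complex_of_real (poisson_disc z \<zeta>) = (1 - z * cnj z) * \<zeta> / ((\<zeta> - z) * (1 - cnj z * \<zeta>))"
proof -
  have zz: "\<zeta> * cnj \<zeta> = 1" using assms by (simp flip: complex_norm_square)
  have "complex_of_real (poisson_disc z \<zeta>) = (1 - z * cnj z) / ((\<zeta> - z) * (cnj \<zeta> - cnj z))"
    unfolding poisson_disc_def
    by (simp only: of_real_divide of_real_diff of_real_1 complex_norm_square complex_cnj_diff)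
  also have "1 - cnj z * \<zeta> = \<zeta> * (cnj \<zeta> - cnj z)" using zz by (simp add: algebra_simps)
  then have "(1 - z * cnj z) / ((\<zeta> - z) * (cnj \<zeta> - cnj z)) =
      (1 - z * cnj z) * \<zeta> / ((\<zeta> - z) * (1 - cnj z * \<zeta>))"
    using zz by (auto simp: divide_simps)
  finally show ?thesis .
qed

text \<open>Cauchy's formula at \<open>z\<close> for \<open>h u * (1 - \<bar>z\<bar>\<^sup>2) / (1 - cnj z * u)\<close>, whose value at \<open>z\<close> is
  \<open>h z\<close> and whose Cauchy kernel is the Poisson kernel.\<close>

lemma poisson_integral_holomorphic:
  fixes h :: "complex \<Rightarrow> complex"
  assumes cont: "continuous_on (cball 0 1) h" and hol: "h holomorphic_on ball 0 1"
    and z: "z \<in> ball 0 1"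
  shows "(LINT \<zeta>|circle_measure. poisson_disc z \<zeta> * h \<zeta>) = h z"
proof -
  define F where "F = (\<lambda>u. h u * (1 - z * cnj z) / (1 - cnj z * u))"
  have nz: "1 - cnj z * u \<noteq> 0" if "u \<in> cball 0 1" for u
  proof -
    have "cmod (cnj z * u) \<le> cmod z" using that by (simp add: norm_mult mult_left_le)
    then show ?thesis using z by auto
  qed
  have "((\<lambda>u. F u / (u - z)) has_contour_integral (2 * of_real pi * \<i> * F z)) (circlepath 0 1)"
    unfolding F_def using nz z cont hol
    by (intro Cauchy_integral_circlepath continuous_intros holomorphic_intros) auto
  then have "((\<lambda>t. F (0 + complex_of_real 1 * cis t) / (0 + complex_of_real 1 * cis t - z) *
        complex_of_real 1 * \<i> * cis t)
      has_integral (2 * of_real pi * \<i> * F z)) {0..2*pi}"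
    unfolding circlepath_def by (subst (asm) has_contour_integral_part_circlepath_iff) auto
  then have "((\<lambda>t. F (cis t) / (cis t - z) * \<i> * cis t)
      has_integral (2 * of_real pi * \<i> * F z)) {0..2*pi}"
    by simp
  \<comment> \<open>The factor \<open>- \<i>\<close> cancels the \<open>\<i>\<close> in the
    derivative of the parametrisation; the remaining \<open>cis t\<close> supplies the numerator of
    the rational form of the kernel.\<close>
  then have 1: "((\<lambda>t. - \<i> * (F (cis t) / (cis t - z) * \<i> * cis t))
      has_integral (- \<i> * (2 * of_real pi * \<i> * F z))) {0..2*pi}"
    by (rule has_integral_mult_right)
  have 2: "- \<i> * (F (cis t) / (cis t - z) * \<i> * cis t) = poisson_disc z (cis t) * h (cis t)" for t
    by (simp add: F_def poisson_disc_complex field_simps)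
  have "F z = h z"
    using nz[of z] z by (simp add: F_def mult.commute)
  then have "integral {0..2*pi} (\<lambda>t. poisson_disc z (cis t) * h (cis t)) = 2 * of_real pi * h z"
    using integral_unique[OF 1] unfolding 2 by (simp add: algebra_simps)
  moreover have "continuous_on (sphere 0 1) (\<lambda>\<zeta>. complex_of_real (poisson_disc z \<zeta>) * h \<zeta>)"
    by (intro continuous_intros continuous_on_poisson_disc z
        continuous_on_subset[OF cont]) (auto)
  ultimately show ?thesis
    by (subst integral_circle_measure) auto
qed

lemma power_mult_power_eq_diff:
  fixes x y :: "'a::comm_monoid_mult"
  assumes "x * y = 1" "n \<le> m"
  shows "x ^ m * y ^ n = x ^ (m - n)"
proof -
  have "x ^ m = x ^ (m - n) * x ^ n"
    using assms(2) by (metis le_add_diff_inverse2 power_add)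
  then have "x ^ m * y ^ n = x ^ (m - n) * (x * y) ^ n"
    by (simp only: power_mult_distrib mult.assoc)
  then show ?thesis using assms(1) by simp
qed

text \<open>Conjugation inverts points of the circle, so only the difference of the exponents
  matters. Natural exponents force the split into a holomorphic power and a conjugated one.\<close>

lemma power_mult_cnj_power_circle:
  assumes "\<zeta> \<in> sphere 0 1"
  shows "\<zeta> ^ a * cnj \<zeta> ^ b = (if b \<le> a then \<zeta> ^ (a - b) else cnj (\<zeta> ^ (b - a)))"
proof -
  have "\<zeta> * cnj \<zeta> = 1" "cnj \<zeta> * \<zeta> = 1"
    using assms by (simp_all add: mult.commute flip: complex_norm_square)
  then show ?thesis
    using power_mult_power_eq_diff[of \<zeta> "cnj \<zeta>" b a] power_mult_power_eq_diff[of "cnj \<zeta>" \<zeta> a b]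
    by (auto simp: mult.commute)
qed

text \<open>Nonnegative frequencies are holomorphic powers; negative ones follow by conjugation,
  because the kernel is real.\<close>

lemma poisson_integral_power_cnj:
  assumes z: "z \<in> ball 0 1"
  shows "(LINT \<zeta>|circle_measure. poisson_disc z \<zeta> * (\<zeta> ^ a * cnj \<zeta> ^ b)) =
    (if b \<le> a then z ^ (a - b) else cnj (z ^ (b - a)))"
proof -
  have pow: "(LINT \<zeta>|circle_measure. poisson_disc z \<zeta> * \<zeta> ^ n) = z ^ n" for n
    by (rule poisson_integral_holomorphic) (use z in \<open>auto intro!: continuous_intros holomorphic_intros\<close>)
  have "(LINT \<zeta>|circle_measure. poisson_disc z \<zeta> * (\<zeta> ^ a * cnj \<zeta> ^ b)) =
      (LINT \<zeta>|circle_measure. (if b \<le> a then poisson_disc z \<zeta> * \<zeta> ^ (a - b)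
         else cnj (poisson_disc z \<zeta> * \<zeta> ^ (b - a))))"
    by (intro Bochner_Integration.integral_cong) (auto simp: power_mult_cnj_power_circle)
  then show ?thesis
    by (simp add: pow del: complex_cnj_mult complex_cnj_power split: if_splits)
qed

text \<open>Characters of the circle are eigenfunctions of the Poisson operator at radius
  \<open>r\<close>; the eigenvalue is \<open>r\<close> to the absolute value of the
  frequency.\<close>

lemma poisson_integral_power_cnj_radial:
  assumes r: "0 \<le> r" "r < 1" and \<xi>: "\<xi> \<in> sphere 0 1"
  shows "(LINT \<zeta>|circle_measure. poisson_disc (of_real r * \<xi>) \<zeta> * (\<zeta> ^ a * cnj \<zeta> ^ b)) =
    of_real r ^ nat \<bar>int a - int b\<bar> * (\<xi> ^ a * cnj \<xi> ^ b)"
proof -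
  have "of_real r * \<xi> \<in> ball 0 1" using r \<xi> by (simp add: norm_mult)
  moreover have "nat \<bar>int a - int b\<bar> = (if b \<le> a then a - b else b - a)" by auto
  ultimately show ?thesis
    by (simp add: poisson_integral_power_cnj power_mult_cnj_power_circle[OF \<xi>] power_mult_distrib)
qed

text \<open>For unimodular points both squared distances equal
  \<open>1 + r^2 - 2 * r * Re (\<xi> * cnj \<eta>)\<close>.\<close>

lemma poisson_disc_radial_commute:
  assumes "cmod \<xi> = 1" "cmod \<eta> = 1"
  shows "poisson_disc (of_real r * \<eta>) \<xi> = poisson_disc (of_real r * \<xi>) \<eta>"
proof -
  have "(cmod (\<xi> - of_real r * \<eta>))\<^sup>2 = (cmod (\<eta> - of_real r * \<xi>))\<^sup>2"
    using assms unfolding cmod_power2 by (simp add: cmod_def) (algebra)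
  then show ?thesis using assms by (simp add: poisson_disc_def norm_mult)
qed

lemma poisson_disc_nonneg: "cmod z \<le> 1 \<Longrightarrow> 0 \<le> poisson_disc z \<zeta>"
  by (simp add: poisson_disc_def power_le_one)

lemma poisson_disc_bound:
  assumes "cmod z \<le> r" "r < 1" "cmod \<zeta> = 1"
  shows "\<bar>poisson_disc z \<zeta>\<bar> \<le> 1 / (1 - r)\<^sup>2"
proof -
  have "1 - r \<le> cmod (\<zeta> - z)"
    using norm_triangle_ineq2[of \<zeta> z] assms by simp
  then have "(1 - r)\<^sup>2 \<le> (cmod (\<zeta> - z))\<^sup>2" using assms by (intro power_mono) auto
  moreover have "0 < (1 - r)\<^sup>2" using assms by simp
  ultimately have "poisson_disc z \<zeta> \<le> 1 / (1 - r)\<^sup>2"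
    unfolding poisson_disc_def by (intro frac_le) auto
  then show ?thesis using poisson_disc_nonneg[of z \<zeta>] assms by simp
qed

lemma borel_measurable_poisson_disc:
  assumes [measurable]: "g \<in> borel_measurable M" "h \<in> borel_measurable M"
  shows "(\<lambda>x. poisson_disc (g x) (h x)) \<in> borel_measurable M"
  unfolding poisson_disc_def by measurable

section \<open>Trigonometric polynomials on the torus\<close>

text \<open>On the torus this is the character with frequencies \<open>a - b\<close> and
  \<open>c - d\<close>. Conjugate powers replace negative exponents, so that products add exponents
  on the whole space and not only on the torus.\<close>

definition torus_monomial :: "nat \<Rightarrow> nat \<Rightarrow> nat \<Rightarrow> nat \<Rightarrow> complex \<times> complex \<Rightarrow> complex" where
  "torus_monomial a b c d \<xi> =
     (fst \<xi> ^ a * cnj (fst \<xi>) ^ b) * (snd \<xi> ^ c * cnj (snd \<xi>) ^ d)"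

text \<open>The rules provide linear combinations only, which makes induction fit statements that
  are linear in the function, such as equality of integrals.\<close>

inductive torus_polynomial :: "(complex \<times> complex \<Rightarrow> complex) \<Rightarrow> bool" where
  monomial: "torus_polynomial (\<lambda>\<xi>. k * torus_monomial a b c d \<xi>)"
| add: "torus_polynomial p \<Longrightarrow> torus_polynomial q \<Longrightarrow> torus_polynomial (\<lambda>\<xi>. p \<xi> + q \<xi>)"

lemma torus_polynomial_mult:
  assumes "torus_polynomial p" "torus_polynomial q"
  shows "torus_polynomial (\<lambda>\<xi>. p \<xi> * q \<xi>)"
  using assms(1)
proof induction
  case (monomial k a b c d)
  show ?case using assms(2)
  proof induction
    case (monomial k' a' b' c' d')
    have "(\<lambda>\<xi>. k * torus_monomial a b c d \<xi> * (k' * torus_monomial a' b' c' d' \<xi>)) =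
        (\<lambda>\<xi>. (k * k') * torus_monomial (a + a') (b + b') (c + c') (d + d') \<xi>)"
      by (simp add: torus_monomial_def power_add mult_ac)
    then show ?case by (simp only: torus_polynomial.monomial)
  next
    case (add p q)
    then show ?case by (simp only: distrib_left torus_polynomial.add)
  qed
next
  case (add p q)
  then show ?case by (simp only: distrib_right torus_polynomial.add)
qed

lemma torus_polynomial_const: "torus_polynomial (\<lambda>\<xi>. k)"
  using monomial[of k 0 0 0 0] by (simp add: torus_monomial_def)

text \<open>A real-linear functional is fixed by its values on the four real basis vectors, and real
  and imaginary parts are combinations of a coordinate and its conjugate. Hence four monomials of
  degree one suffice.\<close>

lemma torus_polynomial_bounded_linear:
  fixes f :: "complex \<times> complex \<Rightarrow> real"
  assumes "bounded_linear f"
  shows "torus_polynomial (\<lambda>\<xi>. of_real (f \<xi>))"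
proof -
  interpret bounded_linear f by fact
  have split: "f \<xi> = Re (fst \<xi>) * f (1, 0) + Im (fst \<xi>) * f (\<i>, 0)
      + (Re (snd \<xi>) * f (0, 1) + Im (snd \<xi>) * f (0, \<i>))" for \<xi>
  proof -
    have "\<xi> = Re (fst \<xi>) *\<^sub>R (1, 0) + Im (fst \<xi>) *\<^sub>R (\<i>, 0)
        + (Re (snd \<xi>) *\<^sub>R (0, 1) + Im (snd \<xi>) *\<^sub>R (0, \<i>))"
      by (simp add: prod_eq_iff complex_eq_iff)
    then have "f \<xi> = f (Re (fst \<xi>) *\<^sub>R (1, 0) + Im (fst \<xi>) *\<^sub>R (\<i>, 0)
        + (Re (snd \<xi>) *\<^sub>R (0, 1) + Im (snd \<xi>) *\<^sub>R (0, \<i>)))"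
      by (rule arg_cong)
    then show ?thesis by (simp only: add scaleR real_scaleR_def)
  qed
  \<comment> \<open>This substitutes \<open>(z + cnj z) / 2\<close> for \<open>Re z\<close> and
    \<open>(z - cnj z) / (2 * \<i>)\<close> for \<open>Im z\<close>.\<close>
  have re_im: "of_real (Re z * x + Im z * y) = (x - \<i> * y) / 2 * z + (x + \<i> * y) / 2 * cnj z"
    for z and x y :: real
    by (simp add: complex_eq_iff field_simps)
  have "(\<lambda>\<xi>. complex_of_real (f \<xi>)) = (\<lambda>\<xi>.
      (((f (1, 0) - \<i> * f (\<i>, 0)) / 2 * torus_monomial 1 0 0 0 \<xi>)
      + ((f (1, 0) + \<i> * f (\<i>, 0)) / 2 * torus_monomial 0 1 0 0 \<xi>))
      + (((f (0, 1) - \<i> * f (0, \<i>)) / 2 * torus_monomial 0 0 1 0 \<xi>)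
      + ((f (0, 1) + \<i> * f (0, \<i>)) / 2 * torus_monomial 0 0 0 1 \<xi>)))"
    (is "_ = ?rhs")
  proof
    fix \<xi>
    show "of_real (f \<xi>) = ?rhs \<xi>"
      unfolding split[of \<xi>] of_real_add[of "Re _ * _ + _"] re_im by (simp add: torus_monomial_def)
  qed
  moreover have "torus_polynomial ?rhs"
    by (intro torus_polynomial.intros)
  ultimately show ?thesis by (simp only:)
qed

lemma torus_polynomial_real_polynomial_function:
  fixes p :: "complex \<times> complex \<Rightarrow> real"
  assumes "real_polynomial_function p"
  shows "torus_polynomial (\<lambda>\<xi>. of_real (p \<xi>))"
  using assms
  by induction (auto intro: torus_polynomial_bounded_linear torus_polynomial_const
      torus_polynomial.add torus_polynomial_mult)

text \<open>Turns the approximants of Stone-Weierstrass, polynomials in the real coordinates, into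
  sums of monomials whose moments are known.\<close>

lemma torus_polynomial_polynomial_function:
  fixes p :: "complex \<times> complex \<Rightarrow> complex"
  assumes "polynomial_function p"
  shows "torus_polynomial p"
proof -
  have "real_polynomial_function (Re \<circ> p)" "real_polynomial_function (Im \<circ> p)"
    using assms bounded_linear_Re bounded_linear_Im unfolding polynomial_function_def by auto
  then have "torus_polynomial (\<lambda>\<xi>. of_real (Re (p \<xi>)) + \<i> * of_real (Im (p \<xi>)))"
    by (intro torus_polynomial.add torus_polynomial_mult torus_polynomial_const)
      (auto dest: torus_polynomial_real_polynomial_function simp: o_def)
  then show ?thesis by (simp flip: complex_eq)
qed

lemma continuous_on_torus_polynomial:
  "torus_polynomial p \<Longrightarrow> continuous_on S p"
  by (induction rule: torus_polynomial.induct)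
    (auto simp: torus_monomial_def intro!: continuous_intros)

section \<open>Moments of torus measures and uniqueness\<close>

text \<open>The measures carry the Borel sets of a subspace, while arithmetic of measurable
  functions takes place in the whole space; the inclusion map is measurable.\<close>

lemma measurable_ident_restrict_borel:
  assumes "sets M = sets (restrict_space borel S)" and "g \<in> measurable N M"
  shows "g \<in> borel_measurable N"
proof -
  have "(\<lambda>x. x) \<in> measurable M borel"
    by (simp add: measurable_cong_sets[OF assms(1) refl] measurable_restrict_space1)
  from measurable_compose[OF assms(2) this] show ?thesis by simp
qed

lemma borel_measurable_fst_snd:
  fixes g :: "'a \<Rightarrow> complex \<times> complex"
  assumes "g \<in> borel_measurable M"
  shows "(\<lambda>x. fst (g x)) \<in> borel_measurable M" "(\<lambda>x. snd (g x)) \<in> borel_measurable M"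
  by (intro borel_measurable_continuous_on[OF _ assms] continuous_intros)+

lemma borel_measurable_torus_monomial:
  assumes [measurable]: "(\<lambda>x. fst (g x)) \<in> borel_measurable M" "(\<lambda>x. snd (g x)) \<in> borel_measurable M"
  shows "(\<lambda>x. torus_monomial a b c d (g x)) \<in> borel_measurable M"
proof -
  have [measurable]: "(\<lambda>x. cnj (fst (g x))) \<in> borel_measurable M" "(\<lambda>x. cnj (snd (g x))) \<in> borel_measurable M"
    by (intro borel_measurable_continuous_on[OF _ assms(1)] borel_measurable_continuous_on[OF _ assms(2)]
        continuous_intros)+
  show ?thesis
    unfolding torus_monomial_def
    by (intro borel_measurable_times borel_measurable_power) fact+
qed

lemma borel_measurable_poisson_bidisc:
  assumes "(\<lambda>x. fst (g x)) \<in> borel_measurable M" "(\<lambda>x. snd (g x)) \<in> borel_measurable M"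
    and "(\<lambda>x. fst (h x)) \<in> borel_measurable M" "(\<lambda>x. snd (h x)) \<in> borel_measurable M"
  shows "(\<lambda>x. poisson_bidisc (g x) (h x)) \<in> borel_measurable M"
  unfolding poisson_bidisc_def
  by (intro borel_measurable_times borel_measurable_poisson_disc assms)

lemma norm_torus_monomial:
  "\<eta> \<in> sphere 0 1 \<times> sphere 0 1 \<Longrightarrow> norm (torus_monomial a b c d \<eta>) = 1"
  by (auto simp: torus_monomial_def norm_mult norm_power)

lemma poisson_bidisc_bound:
  assumes "cmod (fst z) \<le> r" "cmod (snd z) \<le> r" "r < 1" "\<xi> \<in> sphere 0 1 \<times> sphere 0 1"
  shows "\<bar>poisson_bidisc z \<xi>\<bar> \<le> 1 / (1 - r) ^ 4"
proof -
  have "\<bar>poisson_bidisc z \<xi>\<bar> \<le> 1 / (1 - r)\<^sup>2 * (1 / (1 - r)\<^sup>2)"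
    unfolding poisson_bidisc_def abs_mult using assms
    by (intro mult_mono poisson_disc_bound) auto
  also have "\<dots> = 1 / (1 - r) ^ 4"
    by (simp add: power_numeral_reduce power2_eq_square)
  finally show ?thesis .
qed

text \<open>Both sides are the double integral of \<open>torus_monomial a b c d \<eta>\<close> against the Poisson kernel at
  radius \<open>r\<close>, which is symmetric in the two torus points.\<close>

lemma torus_moment_poisson_integral:
  fixes r :: real
  assumes fin: "finite_measure \<mu>"
    and sets: "sets \<mu> = sets (restrict_space borel (sphere 0 1 \<times> sphere 0 1))"
    and r: "0 \<le> r" "r < 1"
  shows "of_real r ^ nat \<bar>int a - int b\<bar> * of_real r ^ nat \<bar>int c - int d\<bar> *
      (LINT \<xi>|\<mu>. torus_monomial a b c d \<xi>) =
    (LINT \<eta>|(circle_measure \<Otimes>\<^sub>M circle_measure). torus_monomial a b c d \<eta> *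
      of_real (LINT \<xi>|\<mu>. poisson_bidisc (of_real r * fst \<eta>, of_real r * snd \<eta>) \<xi>))"
proof -
  let ?C = "circle_measure" let ?N = "?C \<Otimes>\<^sub>M ?C"
  let ?k = "\<lambda>a b z \<zeta>. poisson_disc (of_real r * z) \<zeta> * (\<zeta> ^ a * cnj \<zeta> ^ b)"
  define g where "g = (\<lambda>\<eta> \<xi>. torus_monomial a b c d \<eta> *
    of_real (poisson_bidisc (of_real r * fst \<eta>, of_real r * snd \<eta>) \<xi>))"
  have finC: "finite_measure ?C" by (rule finite_measure_circle_measure)
  have finN: "finite_measure ?N" by (intro finite_measure_pair_measure finC)
  have space\<mu>: "space \<mu> = sphere 0 1 \<times> sphere 0 1"
    using sets_eq_imp_space_eq[OF sets] by (simp add: space_restrict_space)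
  have bound: "norm (g \<eta> \<xi>) \<le> 1 / (1 - r) ^ 4"
    if "\<eta> \<in> sphere 0 1 \<times> sphere 0 1" "\<xi> \<in> sphere 0 1 \<times> sphere 0 1" for \<eta> \<xi>
    using that r unfolding g_def norm_mult norm_torus_monomial[OF that(1)]
    by (auto intro!: poisson_bidisc_bound simp: norm_mult)
  have meas: "(\<lambda>p. fst (fst p)) \<in> borel_measurable (?N \<Otimes>\<^sub>M \<mu>)"
      "(\<lambda>p. snd (fst p)) \<in> borel_measurable (?N \<Otimes>\<^sub>M \<mu>)"
    by (rule measurable_ident_restrict_borel[OF sets_circle_measure]; measurable)+
  have "snd \<in> borel_measurable (?N \<Otimes>\<^sub>M \<mu>)"
    by (rule measurable_ident_restrict_borel[OF sets measurable_snd])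
  note meas = meas borel_measurable_fst_snd[OF this]
  have "case_prod g \<in> borel_measurable (?N \<Otimes>\<^sub>M \<mu>)"
    unfolding g_def case_prod_beta
    by (intro borel_measurable_times measurable_compose[OF _ borel_measurable_of_real] borel_measurable_torus_monomial
        borel_measurable_poisson_bidisc) (auto intro!: borel_measurable_times simp: meas)
  note swap = finite_measure_Fubini_swap[OF finN fin this, of "1 / (1 - r) ^ 4"]
  have inner: "(LINT \<eta>|?N. g \<eta> \<xi>) =
      of_real r ^ nat \<bar>int a - int b\<bar> * of_real r ^ nat \<bar>int c - int d\<bar> * torus_monomial a b c d \<xi>"
    if \<xi>: "\<xi> \<in> sphere 0 1 \<times> sphere 0 1" for \<xi>
  proof -
    have "fst \<in> borel_measurable ?N" "snd \<in> borel_measurable ?N"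
      by (rule measurable_ident_restrict_borel[OF sets_circle_measure]; measurable)+
    then have "case_prod (\<lambda>x y. g (x, y) \<xi>) \<in> borel_measurable ?N"
      unfolding g_def case_prod_beta
      by (intro borel_measurable_times measurable_compose[OF _ borel_measurable_of_real] borel_measurable_torus_monomial
          borel_measurable_poisson_bidisc) simp_all
    from finite_measure_Fubini_pair[OF finC finC this, of "1 / (1 - r) ^ 4"]
    have "(LINT \<eta>|?N. g \<eta> \<xi>) = (LINT x|?C. LINT y|?C. g (x, y) \<xi>)"
      using bound \<xi> by (simp add: split_beta')
    \<comment> \<open>Symmetry of the kernel moves the radius from the integration variables to the
      fixed point \<open>\<xi>\<close>. The integrand is now a function of \<open>x\<close> times a
      function of \<open>y\<close>.\<close>
    also have "\<dots> = (LINT x|?C. LINT y|?C. ?k a b (fst \<xi>) x * ?k c d (snd \<xi>) y)"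
      using \<xi> poisson_disc_radial_commute[of "fst \<xi>" _ r] poisson_disc_radial_commute[of "snd \<xi>" _ r]
      by (intro Bochner_Integration.integral_cong refl)
        (auto simp: g_def poisson_bidisc_def torus_monomial_def mult_ac)
    also have "\<dots> = (LINT x|?C. ?k a b (fst \<xi>) x) * (LINT y|?C. ?k c d (snd \<xi>) y)"
      by simp
    also have "\<dots> = of_real r ^ nat \<bar>int a - int b\<bar> * (fst \<xi> ^ a * cnj (fst \<xi>) ^ b) *
        (of_real r ^ nat \<bar>int c - int d\<bar> * (snd \<xi> ^ c * cnj (snd \<xi>) ^ d))"
      using r \<xi> by (subst (1 2) poisson_integral_power_cnj_radial) auto
    finally show ?thesis by (simp add: torus_monomial_def mult_ac)
  qed
  have "(LINT \<eta>|?N. torus_monomial a b c d \<eta> *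
      of_real (LINT \<xi>|\<mu>. poisson_bidisc (of_real r * fst \<eta>, of_real r * snd \<eta>) \<xi>)) =
      (LINT \<eta>|?N. LINT \<xi>|\<mu>. g \<eta> \<xi>)"
    by (simp add: g_def)
  also have "\<dots> = (LINT \<xi>|\<mu>. LINT \<eta>|?N. g \<eta> \<xi>)"
    using bound by (intro swap) (auto simp: space\<mu> space_pair_measure)
  also have "\<dots> = (LINT \<xi>|\<mu>. of_real r ^ nat \<bar>int a - int b\<bar> * of_real r ^ nat \<bar>int c - int d\<bar> *
      torus_monomial a b c d \<xi>)"
    by (intro Bochner_Integration.integral_cong refl inner) (simp add: space\<mu>)
  finally show ?thesis by simp
qed

lemma torus_measure_eq_if_poisson_integral_eq:
  fixes f :: "complex \<times> complex \<Rightarrow> complex"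
  assumes fin: "finite_measure \<mu>" "finite_measure \<nu>"
    and sets: "sets \<mu> = sets (restrict_space borel (sphere 0 1 \<times> sphere 0 1))"
      "sets \<nu> = sets (restrict_space borel (sphere 0 1 \<times> sphere 0 1))"
    and eq: "\<And>z. z \<in> ball 0 1 \<times> ball 0 1 \<Longrightarrow>
      (LINT \<xi>|\<mu>. poisson_bidisc z \<xi>) = (LINT \<xi>|\<nu>. poisson_bidisc z \<xi>)"
    and cont: "continuous_on (sphere 0 1 \<times> sphere 0 1) f"
  shows "(LINT \<xi>|\<mu>. f \<xi>) = (LINT \<xi>|\<nu>. f \<xi>)"
proof -
  let ?T = "sphere 0 1 \<times> sphere 0 1 :: (complex \<times> complex) set"
  have compact: "compact ?T" by (intro compact_Times compact_sphere)
  note int = integrable_continuous_compact_support[OF fin(1) sets(1) compact]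
    integrable_continuous_compact_support[OF fin(2) sets(2) compact]
  have space: "space \<mu> = ?T" "space \<nu> = ?T"
    using sets[THEN sets_eq_imp_space_eq] by (simp_all add: space_restrict_space)
  have moment: "(LINT \<xi>|\<mu>. torus_monomial a b c d \<xi>) = (LINT \<xi>|\<nu>. torus_monomial a b c d \<xi>)"
    for a b c d
  proof -
    \<comment> \<open>Any radius strictly between 0 and 1 would serve: it keeps the points in the
      bidisc, and its powers are nonzero and can be cancelled from the moments.\<close>
    have half: "0 \<le> (1/2 :: real)" "1/2 < (1 :: real)" by simp_all
    have "(LINT \<xi>|\<mu>. poisson_bidisc (of_real (1/2) * fst \<eta>, of_real (1/2) * snd \<eta>) \<xi>) =
        (LINT \<xi>|\<nu>. poisson_bidisc (of_real (1/2) * fst \<eta>, of_real (1/2) * snd \<eta>) \<xi>)"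
      if "\<eta> \<in> space (circle_measure \<Otimes>\<^sub>M circle_measure)" for \<eta>
      using that by (intro eq) (auto simp: space_pair_measure norm_divide)
    then have "(LINT \<eta>|(circle_measure \<Otimes>\<^sub>M circle_measure). torus_monomial a b c d \<eta> *
        of_real (LINT \<xi>|\<mu>. poisson_bidisc (of_real (1/2) * fst \<eta>, of_real (1/2) * snd \<eta>) \<xi>)) =
        (LINT \<eta>|(circle_measure \<Otimes>\<^sub>M circle_measure). torus_monomial a b c d \<eta> *
        of_real (LINT \<xi>|\<nu>. poisson_bidisc (of_real (1/2) * fst \<eta>, of_real (1/2) * snd \<eta>) \<xi>))"
      by (intro Bochner_Integration.integral_cong) (simp_all only:)
    then have "of_real (1/2) ^ nat \<bar>int a - int b\<bar> * of_real (1/2) ^ nat \<bar>int c - int d\<bar> *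
          (LINT \<xi>|\<mu>. torus_monomial a b c d \<xi>) =
        of_real (1/2) ^ nat \<bar>int a - int b\<bar> * of_real (1/2) ^ nat \<bar>int c - int d\<bar> *
          (LINT \<xi>|\<nu>. torus_monomial a b c d \<xi>)"
      by (simp only: torus_moment_poisson_integral[OF fin(1) sets(1) half] torus_moment_poisson_integral[OF fin(2) sets(2) half])
    then show ?thesis by simp
  qed
  have poly: "(LINT \<xi>|\<mu>. p \<xi>) = (LINT \<xi>|\<nu>. p \<xi>)" if "torus_polynomial p" for p
    using that
  proof induction
    case (monomial k a b c d)
    then show ?case using moment by simp
  next
    case (add p q)
    then show ?case
      by (simp add: int continuous_on_torus_polynomial)
  qed
  define B where "B = measure \<mu> ?T + measure \<nu> ?T"
  \<comment> \<open>The summand 0 gives the shape that \<open>field_le_epsilon\<close>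
    expects.\<close>
  have "norm ((LINT \<xi>|\<mu>. f \<xi>) - (LINT \<xi>|\<nu>. f \<xi>)) \<le> 0 + e" if "e > 0" for e :: real
  proof -
    \<comment> \<open>\<open>B\<close> is the sum of the total masses, so the total error is
      \<open>\<delta> * B\<close>, at most \<open>e\<close>; adding 1 keeps the denominator positive
      when both measures vanish.\<close>
    define \<delta> where "\<delta> = e / (B + 1)"
    have "B \<ge> 0" by (simp add: B_def)
    then have "\<delta> > 0" using that by (simp add: \<delta>_def)
    from Stone_Weierstrass_polynomial_function[OF compact cont this]
    obtain p where p: "torus_polynomial p" and close: "\<And>x. x \<in> ?T \<Longrightarrow> norm (f x - p x) < \<delta>"
      using torus_polynomial_polynomial_function by metis
    have contp: "continuous_on ?T p" by (rule continuous_on_torus_polynomial[OF p])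
    have diff: "norm ((LINT \<xi>|\<rho>. f \<xi>) - (LINT \<xi>|\<rho>. p \<xi>)) \<le> \<delta> * measure \<rho> ?T"
      if \<rho>: "finite_measure \<rho>" "space \<rho> = ?T" "integrable \<rho> f" "integrable \<rho> p" for \<rho>
    proof -
      interpret finite_measure \<rho> by fact
      have "norm ((LINT \<xi>|\<rho>. f \<xi>) - (LINT \<xi>|\<rho>. p \<xi>)) = norm (LINT \<xi>|\<rho>. f \<xi> - p \<xi>)"
        using \<rho> by simp
      also have "\<dots> \<le> (LINT \<xi>|\<rho>. \<delta>)"
        using \<rho> close by (intro Bochner_Integration.integral_norm_bound_integral) (auto intro: less_imp_le)
      finally show ?thesis using \<rho>(2) by (simp add: mult.commute)
    qed
    have "norm ((LINT \<xi>|\<mu>. f \<xi>) - (LINT \<xi>|\<nu>. f \<xi>)) \<le> \<delta> * measure \<mu> ?T + \<delta> * measure \<nu> ?T"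
    proof -
      \<comment> \<open>The integral of \<open>p\<close> is the same for both measures and serves as
        the middle point of the triangle inequality.\<close>
      have "norm ((LINT \<xi>|\<mu>. f \<xi>) - (LINT \<xi>|\<nu>. f \<xi>)) \<le>
          norm ((LINT \<xi>|\<mu>. f \<xi>) - (LINT \<xi>|\<mu>. p \<xi>)) + norm ((LINT \<xi>|\<nu>. f \<xi>) - (LINT \<xi>|\<mu>. p \<xi>))"
        by (metis dist_norm dist_triangle2)
      also have "\<dots> \<le> \<delta> * measure \<mu> ?T + \<delta> * measure \<nu> ?T"
        using diff[OF fin(1) space(1) int(1)[OF cont] int(1)[OF contp]]
          diff[OF fin(2) space(2) int(2)[OF cont] int(2)[OF contp]]
        unfolding poly[OF p] by (rule add_mono)
      finally show ?thesis .
    qed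
    also have "\<dots> = e * (B / (B + 1))"
      by (simp add: \<delta>_def B_def algebra_simps add_divide_distrib)
    also have "\<dots> \<le> e * 1"
      using that \<open>B \<ge> 0\<close> by (intro mult_left_mono) auto
    finally show ?thesis by simp
  qed
  then have "norm ((LINT \<xi>|\<mu>. f \<xi>) - (LINT \<xi>|\<nu>. f \<xi>)) \<le> 0"
    by (rule field_le_epsilon)
  then show ?thesis by simp
qed

section \<open>Convolution of Poisson kernels\<close>

text \<open>Writes the kernel as the real part of the Herglotz kernel, which is holomorphic in
  \<open>\<zeta>\<close>, so that \<open>poisson_integral_holomorphic\<close> can be applied to a
  Poisson kernel.\<close>

lemma poisson_disc_eq_Re:
  assumes "cmod \<zeta> = 1" "cmod w < 1"
  shows "poisson_disc w \<zeta> = Re ((1 + cnj w * \<zeta>) / (1 - cnj w * \<zeta>))"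
proof -
  have "cmod (1 - cnj w * \<zeta>) = cmod (\<zeta> * (cnj \<zeta> - cnj w))"
    using assms by (simp add: algebra_simps flip: complex_norm_square)
  also have "\<dots> = cmod (\<zeta> - w)"
    using assms by (simp add: norm_mult flip: complex_cnj_diff)
  finally have 1: "cmod (1 - cnj w * \<zeta>) = cmod (\<zeta> - w)" .
  have "Re ((1 + u) * cnj (1 - u)) = 1 - (cmod u)\<^sup>2" for u
    unfolding cmod_power2 by (simp add: algebra_simps power2_eq_square)
  then have "Re ((1 + u) / (1 - u)) = (1 - (cmod u)\<^sup>2) / (cmod (1 - u))\<^sup>2" for u
    by (subst complex_div_cnj) (simp add: Re_divide_of_real del: complex_cnj_diff flip: of_real_power)
  from this[of "cnj w * \<zeta>"] show ?thesis
    using assms 1 by (simp add: poisson_disc_def norm_mult)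
qed

text \<open>As a function of \<open>\<zeta>\<close>, the second kernel is a Poisson kernel at
  \<open>v = x * cnj w\<close>, hence the real part of a function \<open>h\<close> holomorphic on
  the disc and continuous up to its boundary. The integral is therefore
  \<open>Re (h z)\<close>.\<close>

lemma poisson_disc_convolution:
  assumes z: "z \<in> ball 0 1" and w: "w \<in> ball 0 1" and x: "x \<in> sphere 0 1"
  shows "(LINT \<zeta>|circle_measure. poisson_disc z \<zeta> * poisson_disc w (x * cnj \<zeta>)) = poisson_disc (z * w) x"
proof -
  define v where "v = x * cnj w"
  have v: "cmod v < 1" using w x by (simp add: v_def norm_mult)
  define h where "h = (\<lambda>u. (1 + cnj v * u) / (1 - cnj v * u))"
  have nz: "1 - cnj v * u \<noteq> 0" if "u \<in> cball 0 1" for u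
  proof -
    have "cmod (cnj v * u) \<le> cmod v" using that by (simp add: norm_mult mult_left_le)
    then show ?thesis using v by auto
  qed
  \<comment> \<open>Conjugating \<open>x * cnj \<zeta> - w\<close> and multiplying by the unimodular
    \<open>x\<close> preserves the modulus and gives \<open>\<zeta> - v\<close>.\<close>
  have reflect: "poisson_disc w (x * cnj \<zeta>) = poisson_disc v \<zeta>" if "\<zeta> \<in> sphere 0 1" for \<zeta>
  proof -
    have "cmod (x * cnj \<zeta> - w) = cmod (cnj (x * cnj \<zeta> - w) * x)"
      using x by (simp add: norm_mult del: complex_cnj_diff)
    also have "cnj (x * cnj \<zeta> - w) * x = \<zeta> * (x * cnj x) - v"
      by (simp add: v_def algebra_simps)
    also have "\<dots> = \<zeta> - v" using x by (simp flip: complex_norm_square)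
    finally show ?thesis using x by (simp add: poisson_disc_def v_def norm_mult)
  qed
  have ch: "continuous_on (cball 0 1) h" unfolding h_def using nz by (intro continuous_intros) auto
  have "(LINT \<zeta>|circle_measure. poisson_disc z \<zeta> * poisson_disc w (x * cnj \<zeta>)) =
      (LINT \<zeta>|circle_measure. Re (poisson_disc z \<zeta> * h \<zeta>))"
    using v by (intro Bochner_Integration.integral_cong) (auto simp: reflect h_def poisson_disc_eq_Re[of _ v]
        simp del: times_divide_eq_right)
  also have "\<dots> = Re (LINT \<zeta>|circle_measure. poisson_disc z \<zeta> * h \<zeta>)"
    using z by (intro integral_Re integrable_circle_measure continuous_intros
        continuous_on_poisson_disc continuous_on_subset[OF ch]) auto
  also have "(LINT \<zeta>|circle_measure. poisson_disc z \<zeta> * h \<zeta>) = h z"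
    using nz z ch by (intro poisson_integral_holomorphic) (auto simp: h_def intro!: holomorphic_intros)
  finally have "(LINT \<zeta>|circle_measure. poisson_disc z \<zeta> * poisson_disc w (x * cnj \<zeta>)) = Re (h z)" .
  moreover have "poisson_disc (z * w) x = Re (h z)"
  proof -
    have "cmod z * cmod w < 1"
      using z w mult_strict_mono[of "cmod z" 1 "cmod w" 1] by auto
    then have "poisson_disc (z * w) x = Re ((1 + cnj (z * w) * x) / (1 - cnj (z * w) * x))"
      using x by (intro poisson_disc_eq_Re) (auto simp: norm_mult)
    \<comment> \<open>The conjugate of \<open>cnj v * z\<close> is \<open>cnj (z * w) * x\<close>,
      and conjugation leaves the real part unchanged.\<close>
    also have "\<dots> = Re (cnj (h z))"
      by (simp add: h_def v_def mult_ac del: cnj.sel)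
    finally show ?thesis by simp
  qed
  ultimately show ?thesis by simp
qed

section \<open>Finiteness of Clark measures\<close>

lemma clark_measure_disc_finite:
  assumes "clark_measure_disc \<phi> \<alpha> \<sigma>"
  shows "finite_measure \<sigma>"
proof -
  have sets: "sets \<sigma> = sets (restrict_space borel (sphere 0 1))"
    and int: "integrable \<sigma> (poisson_disc 0)"
    using assms by (auto simp: clark_measure_disc_def has_bochner_integral_iff)
  have "poisson_disc 0 x = 1" if "x \<in> space \<sigma>" for x
    using that sets_eq_imp_space_eq[OF sets] by (simp add: space_restrict_space poisson_disc_def)
  then have "integrable \<sigma> (\<lambda>x. 1 :: real)"
    using int Bochner_Integration.integrable_cong[OF refl, of \<sigma> "poisson_disc 0" "\<lambda>_. 1"] by simp
  then show ?thesis
    by (intro finite_measureI) (simp add: integrable_iff_bounded)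
qed

lemma clark_measure_bidisc_finite:
  assumes "clark_measure_bidisc \<Phi> \<alpha> \<tau>"
  shows "finite_measure \<tau>"
proof -
  have sets: "sets \<tau> = sets (restrict_space borel (sphere 0 1 \<times> sphere 0 1))"
    and int: "integrable \<tau> (poisson_bidisc (0, 0))"
    using assms by (auto simp: clark_measure_bidisc_def has_bochner_integral_iff)
  have "poisson_bidisc (0, 0) x = 1" if "x \<in> space \<tau>" for x
    using that sets_eq_imp_space_eq[OF sets]
    by (auto simp: space_restrict_space poisson_disc_def poisson_bidisc_def)
  then have "integrable \<tau> (\<lambda>x. 1 :: real)"
    using int Bochner_Integration.integrable_cong[OF refl, of \<tau> "poisson_bidisc (0, 0)" "\<lambda>_. 1"] by simp
  then show ?thesis
    by (intro finite_measureI) (simp add: integrable_iff_bounded)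
qed

section \<open>The image measure on the torus\<close>

text \<open>The target carries the Borel sets of the torus, as \<open>\<tau>\<close> does, so that
  the uniqueness lemma applies to the pair.\<close>

definition skew_product_measure :: "complex measure \<Rightarrow> (complex \<times> complex) measure" where
  "skew_product_measure \<sigma> =
     distr (circle_measure \<Otimes>\<^sub>M \<sigma>) (restrict_space borel (sphere 0 1 \<times> sphere 0 1))
       (\<lambda>(\<zeta>, x). (\<zeta>, x * cnj \<zeta>))"

lemma measurable_skew:
  assumes sets: "sets \<sigma> = sets (restrict_space borel (sphere 0 1))"
  shows "(\<lambda>(\<zeta>, x). (\<zeta>, x * cnj \<zeta>)) \<in>
    measurable (circle_measure \<Otimes>\<^sub>M \<sigma>) (restrict_space borel (sphere 0 1 \<times> sphere 0 1))"
proof (rule measurable_restrict_space2)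
  have space: "space \<sigma> = sphere 0 1"
    using sets_eq_imp_space_eq[OF sets] by (simp add: space_restrict_space)
  show "(\<lambda>(\<zeta>, x). (\<zeta>, x * cnj \<zeta>)) \<in>
      space (circle_measure \<Otimes>\<^sub>M \<sigma>) \<rightarrow> sphere 0 1 \<times> sphere 0 1"
    by (rule funcsetI) (simp add: space_pair_measure space split_beta' mem_Times_iff norm_mult)
  let ?M = "circle_measure \<Otimes>\<^sub>M \<sigma>"
  have fst: "(\<lambda>p. fst p) \<in> borel_measurable ?M"
    by (rule measurable_ident_restrict_borel[OF sets_circle_measure measurable_fst])
  have snd: "(\<lambda>p. snd p) \<in> borel_measurable ?M"
    by (rule measurable_ident_restrict_borel[OF sets measurable_snd])
  have "(\<lambda>p. cnj (fst p)) \<in> borel_measurable ?M"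
    by (rule measurable_compose[OF fst]) (intro borel_measurable_continuous_onI continuous_intros)
  from borel_measurable_Pair[OF fst borel_measurable_times[OF snd this]]
  show "(\<lambda>(\<zeta>, x). (\<zeta>, x * cnj \<zeta>)) \<in> borel_measurable ?M"
    by (simp add: split_beta')
qed

lemma finite_measure_skew_product:
  assumes "finite_measure \<sigma>" and "sets \<sigma> = sets (restrict_space borel (sphere 0 1))"
  shows "finite_measure (skew_product_measure \<sigma>)"
  unfolding skew_product_measure_def
  by (rule finite_measure.finite_measure_distr[OF finite_measure_pair_measure[OF
        assms(1) finite_measure_circle_measure] measurable_skew[OF assms(2)]])

text \<open>Both orders are needed: \<open>\<sigma>\<close> inside gives the iterated integral of
  the theorem, while the circle inside exposes the convolution of kernels.\<close>

lemma integral_skew_product: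
  fixes f :: "complex \<times> complex \<Rightarrow> 'b::{banach, second_countable_topology}"
  assumes fin: "finite_measure \<sigma>" and sets: "sets \<sigma> = sets (restrict_space borel (sphere 0 1))"
    and cont: "continuous_on (sphere 0 1 \<times> sphere 0 1) f"
  shows integral_skew_product_fst:
      "(LINT \<xi>|skew_product_measure \<sigma>. f \<xi>) = (LINT \<zeta>|circle_measure. LINT x|\<sigma>. f (\<zeta>, x * cnj \<zeta>))"
    and integral_skew_product_snd:
      "(LINT \<xi>|skew_product_measure \<sigma>. f \<xi>) = (LINT x|\<sigma>. LINT \<zeta>|circle_measure. f (\<zeta>, x * cnj \<zeta>))"
proof -
  have space: "space \<sigma> = sphere 0 1"
    using sets_eq_imp_space_eq[OF sets] by (simp add: space_restrict_space)
  have fm: "f \<in> borel_measurable (restrict_space borel (sphere 0 1 \<times> sphere 0 1))"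
    by (intro borel_measurable_continuous_on_restrict cont)
  have "case_prod (\<lambda>\<zeta> x. f (\<zeta>, x * cnj \<zeta>)) \<in> borel_measurable (circle_measure \<Otimes>\<^sub>M \<sigma>)"
    using measurable_compose[OF measurable_skew[OF sets] fm] by (simp add: case_prod_beta)
  note Fubini = finite_measure_circle_measure fin this
  have "bounded (f ` (sphere 0 1 \<times> sphere 0 1))"
    by (intro compact_imp_bounded compact_continuous_image cont compact_Times compact_sphere)
  then obtain B where B: "\<And>\<xi>. \<xi> \<in> sphere 0 1 \<times> sphere 0 1 \<Longrightarrow> norm (f \<xi>) \<le> B"
    unfolding bounded_iff by blast
  have bound: "norm (f (\<zeta>, x * cnj \<zeta>)) \<le> B" if "\<zeta> \<in> space circle_measure" "x \<in> space \<sigma>" for \<zeta> x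
    using that by (intro B) (auto simp: space norm_mult)
  show fst: "(LINT \<xi>|skew_product_measure \<sigma>. f \<xi>) =
      (LINT \<zeta>|circle_measure. LINT x|\<sigma>. f (\<zeta>, x * cnj \<zeta>))"
    using finite_measure_Fubini_pair[OF Fubini bound]
    unfolding skew_product_measure_def integral_distr[OF measurable_skew[OF sets] fm]
    by (simp add: split_beta')
  then show "(LINT \<xi>|skew_product_measure \<sigma>. f \<xi>) =
      (LINT x|\<sigma>. LINT \<zeta>|circle_measure. f (\<zeta>, x * cnj \<zeta>))"
    using finite_measure_Fubini_swap[OF Fubini bound] by simp
qed

text \<open>With the circle integral inside, \<open>poisson_disc_convolution\<close> evaluates it
  for each fixed \<open>x\<close>.\<close>

lemma poisson_integral_skew_product:
  assumes fin: "finite_measure \<sigma>" and sets: "sets \<sigma> = sets (restrict_space borel (sphere 0 1))"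
    and z: "z \<in> ball 0 1 \<times> ball 0 1"
  shows "(LINT \<xi>|skew_product_measure \<sigma>. poisson_bidisc z \<xi>) = (LINT x|\<sigma>. poisson_disc (fst z * snd z) x)"
proof -
  have space: "space \<sigma> = sphere 0 1"
    using sets_eq_imp_space_eq[OF sets] by (simp add: space_restrict_space)
  have "continuous_on (sphere 0 1 \<times> sphere 0 1) (poisson_bidisc z)"
    unfolding poisson_bidisc_def using z
    by (intro continuous_intros continuous_on_compose2[OF continuous_on_poisson_disc]) auto
  from integral_skew_product_snd[OF fin sets this]
  show ?thesis
    using z poisson_disc_convolution[of "fst z" "snd z"]
    by (auto simp: poisson_bidisc_def space intro!: Bochner_Integration.integral_cong)
qed

theorem theorem4p3:
  fixes \<phi> :: "complex \<Rightarrow> complex" and \<alpha> :: complex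
    and \<sigma> :: "complex measure" and \<tau> :: "(complex \<times> complex) measure"
    and f :: "complex \<times> complex \<Rightarrow> complex"
  assumes "inner_function \<phi>"
    and "cmod \<alpha> = 1"
    and "clark_measure_disc \<phi> \<alpha> \<sigma>"
    and "clark_measure_bidisc (\<lambda>(z1, z2). \<phi> (z1 * z2)) \<alpha> \<tau>"
    and "continuous_on (sphere 0 1 \<times> sphere 0 1) f"
  shows "(LINT \<xi>|\<tau>. f \<xi>) = (LINT \<zeta>|circle_measure. (LINT x|\<sigma>. f (\<zeta>, x * cnj \<zeta>)))"
proof -
  have fin: "finite_measure \<sigma>" and sets: "sets \<sigma> = sets (restrict_space borel (sphere 0 1))"
    using assms(3) clark_measure_disc_finite by (auto simp: clark_measure_disc_def)
  have poisson: "(LINT \<xi>|\<tau>. poisson_bidisc z \<xi>) = (LINT \<xi>|skew_product_measure \<sigma>. poisson_bidisc z \<xi>)"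
    if z: "z \<in> ball 0 1 \<times> ball 0 1" for z
  proof -
    \<comment> \<open>This is the common value of the two Clark identities: for
      \<open>\<sigma>\<close> at the product of the coordinates, which stays in the disc, and for
      \<open>\<tau>\<close> at \<open>z\<close> itself.\<close>
    let ?u = "(1 - (cmod (\<phi> (fst z * snd z)))\<^sup>2) / (cmod (\<alpha> - \<phi> (fst z * snd z)))\<^sup>2"
    have "cmod (fst z) * cmod (snd z) < 1"
      using z mult_strict_mono[of "cmod (fst z)" 1 "cmod (snd z)" 1] by auto
    then have "(LINT x|\<sigma>. poisson_disc (fst z * snd z) x) = ?u"
      using assms(3) by (auto simp: clark_measure_disc_def has_bochner_integral_iff norm_mult)
    moreover have "(LINT \<xi>|\<tau>. poisson_bidisc z \<xi>) = ?u"
      using assms(4) z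
      by (auto simp: clark_measure_bidisc_def has_bochner_integral_iff case_prod_beta)
    ultimately show ?thesis by (simp add: poisson_integral_skew_product[OF fin sets z])
  qed
  have "(LINT \<xi>|\<tau>. f \<xi>) = (LINT \<xi>|skew_product_measure \<sigma>. f \<xi>)"
    using assms(4) clark_measure_bidisc_finite[OF assms(4)] finite_measure_skew_product[OF fin sets] poisson
    by (intro torus_measure_eq_if_poisson_integral_eq assms(5))
      (auto simp: clark_measure_bidisc_def skew_product_measure_def)
  also have "\<dots> = (LINT \<zeta>|circle_measure. (LINT x|\<sigma>. f (\<zeta>, x * cnj \<zeta>)))"
    by (rule integral_skew_product_fst[OF fin sets assms(5)])
  finally show ?thesis .
qed

end
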